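(* Let $\beta^2=1-e^2$. If $f_1$ and $f_2$ are two solutions to $$\frac{\partial f}{\partial t}=\tilde Q_e(f,f)$$ with respective initial data $f_1^0$ and $f_2^0$ in $\mathcal P_2(\mathbb R^3)$ with zero mean velocity, then, for all $t\ge0$, $$W_2^2(f_1(t),f_2(t))\le W_2^2(f_1^0,f_2^0).$$
   Context: $\mathcal P_2(\mathbb R^3)$ is the set of Borel probability measures on $\mathbb R^3$ with finite second moment (written as densities $f(v)\,dv$ even if not absolutely continuous). The mean velocity of $f$ is $\int v f(v)\,dv$. Let $0\le e\le 1$ and let $\eta$ be a real random variable with law a probability measure $\mu$ supported in $[-e,\infty)$, with $\langle\eta\rangle=0$ and $\langle\eta^2\rangle=\beta^2$, where $\langle\cdot\rangle$ denotes expectation with respect to $\eta$ (integration against $\mu$). Put $\tilde e=e+\eta\ge0$. For $v,w\in\mathbb R^3$, $\sigma\in S^2$, the post-collision velocity is $$v'=\tfrac12(v+w)+\tfrac{1-\tilde e}{4}(v-w)+\tfrac{1+\tilde e}{4}|v-w|\sigma .$$ The collision operator is defined weakly by $$(\varphi,\tilde Q_e(f,f))=\frac1{4\pi}\Big\langle\int_{\mathbb R^3}\int_{\mathbb R^3}\int_{S^2} f(v)f(w)\,[\varphi(v')-\varphi(v)]\,d\sigma\,dv\,dw\Big\rangle$$ for test functions $\varphi$ (e.g. bounded continuous). A solution is a time-dependent probability measure $f(t)$ satisfying $\frac{d}{dt}\int\varphi f(t)=(\varphi,\tilde Q_e(f(t),f(t)))$ for all such $\varphi$, with the prescribed initial datum.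 The condition $\beta^2=1-e^2$ is the "conservative in the mean" case. $W_2(f,g)=\inf_{\Pi}\big(\iint |v-x|^2\,d\Pi(v,x)\big)^{1/2}$, the infimum being over all joint probability measures $\Pi$ with marginals $f$ and $g$. *)

theory Defs
  imports "HOL-Probability.Probability"
begin

definition P2 :: "(real^3) measure set" where
  "P2 = {f. prob_space f \<and> sets f = sets borel \<and> integrable f (\<lambda>v. (norm v)\<^sup>2)}"

definition mean_velocity :: "(real^3) measure \<Rightarrow> real^3" where
  "mean_velocity f = (LINT v|f. v)"

definition couplings ::
    "(real^3) measure \<Rightarrow> (real^3) measure \<Rightarrow> ((real^3) \<times> (real^3)) measure set" where
  "couplings f g = {\<pi>. prob_space \<pi> \<and> sets \<pi> = sets (borel \<Otimes>\<^sub>M borel) \<and>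
     distr \<pi> borel fst = f \<and> distr \<pi> borel snd = g}"

definition ennreal_sqrt :: "ennreal \<Rightarrow> ennreal" where
  "ennreal_sqrt x = (if x = \<top> then \<top> else ennreal (sqrt (enn2real x)))"

(* Extended-valued, so that a coupling of infinite cost contributes \<top>; with a real-valued
   Bochner integral it would contribute 0. On P2 the distance is finite. *)
definition W2 :: "(real^3) measure \<Rightarrow> (real^3) measure \<Rightarrow> ennreal" where
  "W2 f g = (INF \<pi>\<in>couplings f g.
     ennreal_sqrt (\<integral>\<^sup>+ p. ennreal ((norm (fst p - snd p))\<^sup>2) \<partial>\<pi>))"

(* Surface measure d\<sigma> of the unit sphere, of total mass 4 * pi, given by the cone formula
   \<sigma>(A) = 3 * Leb {r x | x \<in> A, 0 < r < 1} for Borel sets A of the unit sphere, that is, by polar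
   coordinates d\<sigma>(A) \<integral>_0^1 r^2 dr = Leb(cone over A). As a measure it lives
   on all of real^3, concentrated on the sphere. *)
definition sphere_measure :: "(real^3) measure" where
  "sphere_measure =
     distr (density lborel (\<lambda>x. 3 * indicator (ball 0 1) x)) borel (\<lambda>x. x /\<^sub>R norm x)"

lemma emeasure_sphere_measure:
  "emeasure sphere_measure (sphere 0 1) = ennreal (4 * pi)"
proof -
  let ?U = "(\<lambda>x::real^3. x /\<^sub>R norm x) -` sphere 0 1"
  have U: "?U = - {0}" by (auto simp: dist_norm)
  have m: "(\<lambda>x::real^3. x /\<^sub>R norm x) \<in> borel \<rightarrow>\<^sub>M borel" by measurable
  have d: "(\<lambda>x::real^3. 3 * indicator (ball 0 1) x :: ennreal) \<in> borel_measurable lborel"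
    by (intro borel_measurable_times_ennreal borel_measurable_const borel_measurable_indicator) simp
  have s: "- {0::real^3} \<in> sets borel" by simp
  have "emeasure sphere_measure (sphere 0 1) = (\<integral>\<^sup>+x. 3 * indicator (ball 0 1) x * indicator (- {0}) x \<partial>(lborel::(real^3) measure))"
    unfolding sphere_measure_def using m emeasure_density[OF d] s
    by (subst emeasure_distr) (simp_all add: U)
  also have "\<dots> = (\<integral>\<^sup>+x. 3 * indicator (ball 0 1) x \<partial>(lborel::(real^3) measure))"
    by (rule nn_integral_cong_AE) (use AE_lborel_singleton[of "0::real^3"] in \<open>auto elim!: eventually_mono\<close>)
  also have "\<dots> = 3 * emeasure lborel (ball (0::real^3) 1)"
    by (rule nn_integral_cmult_indicator) simp
  also have "\<dots> = ennreal (4*pi)"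
    by (simp add: emeasure_ball unit_ball_vol_3 flip: ennreal_numeral ennreal_mult)
  finally show ?thesis .
qed

definition post_velocity ::
    "real \<Rightarrow> real^3 \<Rightarrow> real^3 \<Rightarrow> real^3 \<Rightarrow> real^3" where
  "post_velocity e' v w \<sigma> =
     (1/2) *\<^sub>R (v + w) + ((1 - e') / 4) *\<^sub>R (v - w) + ((1 + e') / 4 * norm (v - w)) *\<^sub>R \<sigma>"

(* The number (\<phi>, Q(f,f)); \<mu> is the law of the random part \<eta> of the restitution coefficient. *)
definition collision_op ::
    "real \<Rightarrow> real measure \<Rightarrow> (real^3) measure \<Rightarrow> (real^3 \<Rightarrow> real) \<Rightarrow> real" where
  "collision_op e \<mu> f \<phi> =
     1 / (4 * pi) * (LINT \<eta>|\<mu>. LINT w|f. LINT v|f. LINT \<sigma>|sphere_measure.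
        \<phi> (post_velocity (e + \<eta>) v w \<sigma>) - \<phi> v)"

definition is_solution ::
    "real \<Rightarrow> real measure \<Rightarrow> (real^3) measure \<Rightarrow> (real \<Rightarrow> (real^3) measure) \<Rightarrow> bool" where
  "is_solution e \<mu> f0 f \<longleftrightarrow>
     f 0 = f0 \<and>
     (\<forall>t\<ge>0. prob_space (f t) \<and> sets (f t) = sets borel) \<and>
     (\<forall>\<phi>. continuous_on UNIV \<phi> \<and> bounded (range \<phi>) \<longrightarrow>
        (\<forall>t\<ge>0. ((\<lambda>s. LINT v|f s. \<phi> v) has_real_derivative collision_op e \<mu> (f t) \<phi>)
                 (at t within {0..})))"

end

theory Submission
  imports Defs
begin

text \<open>
  The proof is Tanaka's coupling argument, carried out on the Wild sum: any coupling of the initial data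
  is propagated by a coupled collision dynamics that does not increase its quadratic cost.

  Let two pairs of particles collide with the same restitution coefficient \<open>e + \<eta>\<close> and the same
  direction \<open>\<sigma>\<close>. When the second moment of \<open>e + \<eta>\<close> is 1, which is the meaning of conservation of energy in
  the mean, the expected squared distance of the outcomes is at most \<open>(3 - e) / 4\<close> times the squared
  distance of the first particles plus \<open>(1 + e) / 4\<close> times that of the second particles
  (\<open>post_velocity_contraction\<close>). The two weights add up to 1, so a joint law of two velocities whose
  quadratic cost is at most \<open>C\<close> still has cost at most \<open>C\<close> after any number of such collisions
  (\<open>nn_integral_wild_le\<close>).

  It remains to see that solutions are made of such collisions. The equation reads \<open>f' = gain f f - f\<close>, and its
  solution is the Wild sum: \<open>f t\<close> is the mixture, with geometric weights
  \<open>exp (- t) * (1 - exp (- t)) ^ n\<close>, of the laws of a particle with \<open>n\<close> collisions in its history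
  (\<open>weak_solution_eq_wild_sum\<close>). Integrating the equation repeatedly shows that every solution is
  bounded below by each partial sum, and as the weights have total mass 1 the lower bound is an equality.

  The theory of Wild sums is developed for an arbitrary random collision rule on a metric space, and
  is used twice: for single velocities, and for pairs of velocities with the coupled rule. The second
  Wild sum, started from a coupling of the initial data, is a coupling of the two solutions whose
  cost is at most that of the initial coupling (\<open>coupling_of_solutions\<close>). Taking the infimum
  over the initial couplings gives the theorem.
\<close>

section \<open>The uniform measure on the sphere\<close>

definition sphere_unif :: "(real^3) measure" where
  "sphere_unif = density sphere_measure (\<lambda>_. ennreal (1 / (4 * pi)))"

lemma sets_sphere_measure [measurable_cong]: "sets sphere_measure = sets borel"
  by (simp add: sphere_measure_def)

lemma space_sphere_measure [simp]: "space sphere_measure = UNIV"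
  by (simp add: sphere_measure_def)

lemma sets_sphere_unif [measurable_cong]: "sets sphere_unif = sets borel"
  by (simp add: sphere_unif_def sets_sphere_measure)

text \<open>Normalized surface measure is the law of the direction of a uniform point of the unit ball.\<close>
lemma nn_integral_sphere_unif:
  assumes [measurable]: "g \<in> borel_measurable borel"
  shows "(\<integral>\<^sup>+x. g x \<partial>sphere_unif) = ennreal (3 / (4 * pi)) * (\<integral>\<^sup>+x. indicator (ball 0 1) x * g (x /\<^sub>R norm x) \<partial>lborel)"
proof -
  have [measurable]: "(\<lambda>x::real^3. indicator (ball 0 1) x * g (x /\<^sub>R norm x)) \<in> borel_measurable borel"
    by (intro borel_measurable_times_ennreal borel_measurable_indicator) auto
  have "(\<integral>\<^sup>+x. g x \<partial>sphere_unif) = ennreal (1 / (4 * pi)) * (\<integral>\<^sup>+x. g x \<partial>sphere_measure)"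
    unfolding sphere_unif_def by (subst nn_integral_density) (auto simp: nn_integral_cmult)
  also have "(\<integral>\<^sup>+x. g x \<partial>sphere_measure) = (\<integral>\<^sup>+x. 3 * (indicator (ball 0 1) x * g (x /\<^sub>R norm x)) \<partial>lborel)"
    unfolding sphere_measure_def
  proof (subst nn_integral_distr)
    show "(\<integral>\<^sup>+x. g (x /\<^sub>R norm x) \<partial>density lborel (\<lambda>x. 3 * indicator (ball 0 1) x)) =
        (\<integral>\<^sup>+x. 3 * (indicator (ball 0 1) x * g (x /\<^sub>R norm x)) \<partial>lborel)"
      by (subst nn_integral_density)
         (auto intro!: borel_measurable_times_ennreal borel_measurable_indicator simp: ac_simps)
  qed simp_all
  also have "\<dots> = 3 * (\<integral>\<^sup>+x. indicator (ball 0 1) x * g (x /\<^sub>R norm x) \<partial>lborel)"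
    by (subst nn_integral_cmult) auto
  also have "ennreal (1 / (4 * pi)) * \<dots> = ennreal (1/(4*pi) * 3) * (\<integral>\<^sup>+x. indicator (ball 0 1) x * g (x /\<^sub>R norm x) \<partial>lborel)"
    by (subst ennreal_mult) (auto simp: ac_simps)
  finally show ?thesis by simp
qed

lemma prob_space_sphere_unif: "prob_space sphere_unif"
proof
  have "emeasure sphere_unif (space sphere_unif) = (\<integral>\<^sup>+x. 1 \<partial>sphere_unif)" by simp
  also have "\<dots> = ennreal (3 / (4 * pi)) * emeasure lborel (ball (0::real^3) 1)"
    by (subst nn_integral_sphere_unif) simp_all
  also have "\<dots> = 1"
    by (simp add: emeasure_ball unit_ball_vol_3 flip: ennreal_mult)
  finally show "emeasure sphere_unif (space sphere_unif) = 1" .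
qed

lemma AE_sphere_unif: "AE x in sphere_unif. norm x = 1"
proof -
  have "(\<integral>\<^sup>+x. indicator {x. norm x \<noteq> 1} x \<partial>sphere_unif) = 
     ennreal (3 / (4 * pi)) * (\<integral>\<^sup>+x. indicator (ball 0 1) x * indicator {x. norm x \<noteq> 1} (x /\<^sub>R norm x) \<partial>(lborel::(real^3) measure))"
    by (subst nn_integral_sphere_unif) simp_all
  also have "(\<integral>\<^sup>+x. indicator (ball 0 1) x * indicator {x. norm x \<noteq> 1} (x /\<^sub>R norm x) \<partial>(lborel::(real^3) measure)) = (\<integral>\<^sup>+x. 0 \<partial>(lborel::(real^3) measure))"
    by (rule nn_integral_cong_AE) (use AE_lborel_singleton[of "0::real^3"] in \<open>auto elim!: eventually_mono\<close>)
  finally have "emeasure sphere_unif {x. norm x \<noteq> 1} = 0"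
    by (simp add: nn_integral_indicator sets_sphere_unif)
  then show ?thesis
    by (subst AE_iff_measurable[of "{x. norm x \<noteq> 1}"]) (auto simp: sphere_unif_def)
qed

lemma sphere_unif_uminus: "distr sphere_unif borel uminus = sphere_unif"
proof (rule measure_eqI)
  fix A :: "(real^3) set" assume "A \<in> sets (distr sphere_unif borel uminus)"
  then have [measurable]: "A \<in> sets borel" by simp
  \<comment> \<open>Lebesgue measure is invariant under the reflection in the origin.\<close>
  have m: "lborel = distr lborel borel (uminus :: real^3 \<Rightarrow> _)"
    using lborel_affine[of "-1" "0::real^3"] by (simp add: density_1 fun_Compl_def)
  have "emeasure (distr sphere_unif borel uminus) A = (\<integral>\<^sup>+x. indicator A x \<partial>distr sphere_unif borel uminus)"
    by simp
  also have "\<dots> = (\<integral>\<^sup>+x. indicator A (-x) \<partial>sphere_unif)"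
    by (subst nn_integral_distr) auto
  also have "\<dots> = ennreal (3 / (4 * pi)) * (\<integral>\<^sup>+x. indicator (ball 0 1) x * indicator A (- (x /\<^sub>R norm x)) \<partial>(lborel::(real^3) measure))"
    by (subst nn_integral_sphere_unif) simp_all
  also have "(\<integral>\<^sup>+x. indicator (ball 0 1) x * indicator A (- (x /\<^sub>R norm x)) \<partial>(lborel::(real^3) measure)) =
     (\<integral>\<^sup>+x. indicator (ball 0 1) x * indicator A (x /\<^sub>R norm x) \<partial>(lborel::(real^3) measure))"
    by (subst (2) m, subst nn_integral_distr) (auto simp: indicator_def intro!: nn_integral_cong)
  also have "ennreal (3 / (4 * pi)) * \<dots> = (\<integral>\<^sup>+x. indicator A x \<partial>sphere_unif)"
    by (subst nn_integral_sphere_unif) simp_all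
  finally show "emeasure (distr sphere_unif borel uminus) A = emeasure sphere_unif A" 
    by (simp add: sets_sphere_unif)
qed (simp add: sets_sphere_unif)

lemma integrable_sphere_unif:
  fixes f :: "real^3 \<Rightarrow> 'b::{banach, second_countable_topology}"
  assumes [measurable]: "f \<in> borel_measurable borel" and "\<And>x. norm x = 1 \<Longrightarrow> norm (f x) \<le> B"
  shows "integrable sphere_unif f"
proof -
  interpret prob_space sphere_unif by (rule prob_space_sphere_unif)
  show ?thesis
    by (rule integrable_const_bound[where B=B])
       (use AE_sphere_unif in \<open>auto intro!: assms elim!: eventually_mono\<close>)
qed

lemma integral_sphere_unif_id: "(LINT x|sphere_unif. x) = 0"
proof -
  have "(LINT x|sphere_unif. x) = (LINT x|distr sphere_unif borel uminus. x)"
    by (simp add: sphere_unif_uminus)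
  also have "\<dots> = (LINT x|sphere_unif. - x)"
    by (subst integral_distr) auto
  also have "\<dots> = - (LINT x|sphere_unif. x)" by simp
  finally have "2 *\<^sub>R (LINT x|sphere_unif. x) = 0"
    by (simp add: scaleR_2 eq_neg_iff_add_eq_0)
  then show ?thesis unfolding scaleR_eq_0_iff by simp
qed

lemma norm_sq_add_scaleR:
  fixes a x :: "'a::real_inner"
  shows "(norm (a + r *\<^sub>R x))\<^sup>2 = (norm a)\<^sup>2 + r\<^sup>2 * (norm x)\<^sup>2 + 2 * r * (a \<bullet> x)"
  unfolding power2_norm_eq_inner by (simp add: inner_simps inner_commute power2_eq_square algebra_simps)

text \<open>
  The mean of \<open>a + r \<sigma>\<close> over a uniform unit vector \<open>\<sigma>\<close> is \<open>a\<close> and its variance is \<open>r\<^sup>2\<close>. Applied to the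
  difference of two points with the same \<open>\<sigma>\<close> on two spheres, this is the cost of moving the uniform
  measure of one sphere to that of the other by a translation and a dilation: the squared distance of
  the centres plus the squared difference of the radii.
\<close>
lemma sphere_average_norm_sq:
  "(\<integral>\<^sup>+x. ennreal ((norm (a + r *\<^sub>R x))\<^sup>2) \<partial>sphere_unif) = ennreal ((norm a)\<^sup>2 + r\<^sup>2)"
proof -
  interpret prob_space sphere_unif by (rule prob_space_sphere_unif)
  have "(\<integral>\<^sup>+x. ennreal ((norm (a + r *\<^sub>R x))\<^sup>2) \<partial>sphere_unif) = 
     (\<integral>\<^sup>+x. ennreal ((norm a)\<^sup>2 + r\<^sup>2 + 2 * r * (a \<bullet> x)) \<partial>sphere_unif)"
    by (rule nn_integral_cong_AE)
      (use AE_sphere_unif in \<open>auto elim!: eventually_mono simp: norm_sq_add_scaleR\<close>)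
  also have "\<dots> = ennreal (LINT x|sphere_unif. (norm a)\<^sup>2 + r\<^sup>2 + 2 * r * (a \<bullet> x))"
  proof (rule nn_integral_eq_integral)
    show "AE x in sphere_unif. 0 \<le> (norm a)\<^sup>2 + r\<^sup>2 + 2 * r * (a \<bullet> x)"
      using AE_sphere_unif
    proof eventually_elim
      case (elim x)
      have "(norm a)\<^sup>2 + r\<^sup>2 + 2 * r * (a \<bullet> x) = (norm (a + r *\<^sub>R x))\<^sup>2"
        using elim by (simp add: norm_sq_add_scaleR)
      then show ?case by simp
    qed
    show "integrable sphere_unif (\<lambda>x. (norm a)\<^sup>2 + r\<^sup>2 + 2 * r * (a \<bullet> x))"
      by (intro Bochner_Integration.integrable_add integrable_const integrable_mult_right integrable_inner_right integrable_sphere_unif[where B=1]) auto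
  qed
  also have "(LINT x|sphere_unif. (norm a)\<^sup>2 + r\<^sup>2 + 2 * r * (a \<bullet> x)) = (norm a)\<^sup>2 + r\<^sup>2"
  proof -
    have i: "integrable sphere_unif (\<lambda>x. x)" by (rule integrable_sphere_unif[where B=1]) auto
    have "(LINT x|sphere_unif. (norm a)\<^sup>2 + r\<^sup>2 + 2 * r * (a \<bullet> x)) = (norm a)\<^sup>2 + r\<^sup>2 + 2 * r * (a \<bullet> (LINT x|sphere_unif. x))"
      using i by (simp add: prob_space)
    then show ?thesis by (simp add: integral_sphere_unif_id)
  qed
  finally show ?thesis .
qed

section \<open>Contraction in a single collision\<close>

text \<open>
  The contraction estimate for a single collision. If the two collisions share \<open>\<eta>\<close> and \<open>\<sigma>\<close>, the
  difference of the two outcomes is \<open>a X + b Y + b r \<sigma>\<close> with \<open>X = v - x\<close>, \<open>Y = w - y\<close> and \<open>r\<close> the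
  difference of the relative speeds, \<open>\<bar>r\<bar> \<le> norm (X - Y)\<close>. Averaging over \<open>\<sigma>\<close> and bounding \<open>r\<close> leaves a quadratic
  form in \<open>X\<close> and \<open>Y\<close>. Since \<open>e + \<eta>\<close> has mean \<open>e\<close> and, by conservation of energy in the mean, second
  moment 1, its averages over \<open>\<eta>\<close> are explicit: the coefficient \<open>(1 - (e + \<eta>)\<^sup>2) / 4\<close> of the cross
  term \<open>X \<bullet> Y\<close> averages to 0, and the coefficients of the squares average to two weights of sum 1.
  The bounds on \<open>e\<close> say that these weights are nonnegative.
\<close>
lemma post_velocity_contraction:
  assumes "prob_space \<mu>" and sets: "sets \<mu> = sets borel"
    and i1: "integrable \<mu> (\<lambda>\<eta>. \<eta>)" and m1: "(LINT \<eta>|\<mu>. \<eta>) = 0"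
    and i2: "integrable \<mu> (\<lambda>\<eta>. \<eta>\<^sup>2)" and m2: "(LINT \<eta>|\<mu>. \<eta>\<^sup>2) = 1 - e\<^sup>2"
    and e: "-1 \<le> e" "e \<le> 3"
  shows "(\<integral>\<^sup>+p. ennreal ((norm (post_velocity (e + fst p) v w (snd p) - post_velocity (e + fst p) x y (snd p)))\<^sup>2)
            \<partial>(\<mu> \<Otimes>\<^sub>M sphere_unif))
       \<le> ennreal ((3 - e) / 4) * ennreal ((norm (v - x))\<^sup>2) + ennreal ((1 + e) / 4) * ennreal ((norm (w - y))\<^sup>2)"
proof -
  interpret M: prob_space \<mu> by fact
  interpret S: prob_space sphere_unif by (rule prob_space_sphere_unif)
  note [measurable_cong] = sets
  define X Y where "X = v - x" and "Y = w - y"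
  define r where "r = norm (v - w) - norm (x - y)"
  define a where "a \<eta> = (3 - (e+\<eta>)) / 4" for \<eta>
  define b where "b \<eta> = (1 + (e+\<eta>)) / 4" for \<eta>
  have [measurable]: "a \<in> borel_measurable borel" "b \<in> borel_measurable borel" by (simp_all add: a_def[abs_def] b_def[abs_def])
  have diff: "post_velocity (e + \<eta>) v w s - post_velocity (e + \<eta>) x y s = (a \<eta> *\<^sub>R X + b \<eta> *\<^sub>R Y) + (b \<eta> * r) *\<^sub>R s" for \<eta> s
    by (simp add: post_velocity_def X_def Y_def r_def a_def b_def vec_eq_iff algebra_simps add_divide_distrib diff_divide_distrib)
  have r: "r\<^sup>2 \<le> (norm (X - Y))\<^sup>2"
  proof -
    have "\<bar>r\<bar> \<le> norm ((v - w) - (x - y))" unfolding r_def by (rule norm_triangle_ineq3)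
    also have "(v - w) - (x - y) = X - Y" by (simp add: X_def Y_def)
    finally show ?thesis by (metis abs_le_square_iff abs_norm_cancel)
  qed
  have P_eq: "(norm (a \<eta> *\<^sub>R X + b \<eta> *\<^sub>R Y))\<^sup>2 + (b \<eta>)\<^sup>2 * (norm (X - Y))\<^sup>2 =
     (norm X)\<^sup>2 * ((a \<eta>)\<^sup>2 + (b \<eta>)\<^sup>2) + (norm Y)\<^sup>2 * (2 * (b \<eta>)\<^sup>2) + (X \<bullet> Y) * (2 * b \<eta> * (a \<eta> - b \<eta>))" for \<eta>
    unfolding power2_norm_eq_inner
    by (simp add: inner_simps inner_commute power2_eq_square algebra_simps)
  \<comment> \<open>Written as a polynomial in \<open>\<eta>\<close>, so that only the first two moments of \<open>\<mu>\<close> enter.\<close>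
  have P_poly: "(norm X)\<^sup>2 * ((a \<eta>)\<^sup>2 + (b \<eta>)\<^sup>2) + (norm Y)\<^sup>2 * (2 * (b \<eta>)\<^sup>2) + (X \<bullet> Y) * (2 * b \<eta> * (a \<eta> - b \<eta>)) =
      \<eta>\<^sup>2 * ((norm X)\<^sup>2 / 8 + (norm Y)\<^sup>2 / 8 - (X \<bullet> Y) / 4)
    + \<eta> * ((norm X)\<^sup>2 * (e - 1) / 4 + (norm Y)\<^sup>2 * (1 + e) / 4 - (X \<bullet> Y) * e / 2)
    + ((norm X)\<^sup>2 * (5 - 2 * e + e\<^sup>2) / 8 + (norm Y)\<^sup>2 * (1 + e)\<^sup>2 / 8 + (X \<bullet> Y) * (1 - e\<^sup>2) / 4)" for \<eta>
    by (simp add: a_def b_def power2_eq_square field_simps)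
  have "(\<integral>\<^sup>+p. ennreal ((norm (post_velocity (e + fst p) v w (snd p) - post_velocity (e + fst p) x y (snd p)))\<^sup>2) \<partial>(\<mu> \<Otimes>\<^sub>M sphere_unif))
     = (\<integral>\<^sup>+\<eta>. \<integral>\<^sup>+s. ennreal ((norm ((a \<eta> *\<^sub>R X + b \<eta> *\<^sub>R Y) + (b \<eta> * r) *\<^sub>R s))\<^sup>2) \<partial>sphere_unif \<partial>\<mu>)"
    unfolding diff by (subst S.nn_integral_fst[symmetric]) (auto simp: comp_def)
  also have "\<dots> = (\<integral>\<^sup>+\<eta>. ennreal ((norm (a \<eta> *\<^sub>R X + b \<eta> *\<^sub>R Y))\<^sup>2 + (b \<eta> * r)\<^sup>2) \<partial>\<mu>)"
    by (simp add: sphere_average_norm_sq)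
  also have "\<dots> \<le> (\<integral>\<^sup>+\<eta>. ennreal ((norm (a \<eta> *\<^sub>R X + b \<eta> *\<^sub>R Y))\<^sup>2 + (b \<eta>)\<^sup>2 * (norm (X - Y))\<^sup>2) \<partial>\<mu>)"
    using r by (intro nn_integral_mono ennreal_leI add_left_mono) (simp add: power_mult_distrib mult_left_mono)
  also have "\<dots> = (\<integral>\<^sup>+\<eta>. ennreal ((norm X)\<^sup>2 * ((a \<eta>)\<^sup>2 + (b \<eta>)\<^sup>2) + (norm Y)\<^sup>2 * (2 * (b \<eta>)\<^sup>2) + (X \<bullet> Y) * (2 * b \<eta> * (a \<eta> - b \<eta>))) \<partial>\<mu>)"
    unfolding P_eq ..
  also have "\<dots> = ennreal (LINT \<eta>|\<mu>. (norm X)\<^sup>2 * ((a \<eta>)\<^sup>2 + (b \<eta>)\<^sup>2) + (norm Y)\<^sup>2 * (2 * (b \<eta>)\<^sup>2) + (X \<bullet> Y) * (2 * b \<eta> * (a \<eta> - b \<eta>)))"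
    (is "_ = ennreal (LINT \<eta>|\<mu>. ?P \<eta>)")
  proof (rule nn_integral_eq_integral)
    have "0 \<le> ?P \<eta>" for \<eta> unfolding P_eq[symmetric] by simp
    then show "AE \<eta> in \<mu>. 0 \<le> ?P \<eta>" by simp
    show "integrable \<mu> ?P" unfolding P_poly using i1 i2 by simp
  qed
  also have "(LINT \<eta>|\<mu>. ?P \<eta>) = (3 - e) / 4 * (norm X)\<^sup>2 + (1 + e) / 4 * (norm Y)\<^sup>2"
    unfolding P_poly using i1 i2
    by (simp add: m1 m2 M.prob_space) (simp add: field_simps power2_eq_square)
  also have "\<dots> = ennreal ((3 - e) / 4) * ennreal ((norm X)\<^sup>2) + ennreal ((1 + e) / 4) * ennreal ((norm Y)\<^sup>2)"
    using e by (subst ennreal_plus) (auto simp flip: ennreal_mult)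
  finally show ?thesis by (simp only: X_def Y_def)
qed

section \<open>Measures and continuous functions\<close>

text \<open>
  An inequality suffices: both measures have mass 1, so testing also \<open>1 - \<phi>\<close> turns it into an equality.
\<close>
lemma measure_eq_if_continuous_integrals_le:
  fixes A B :: "'a::metric_space measure"
  assumes "prob_space A" "prob_space B" and sA: "sets A = sets borel" and sB: "sets B = sets borel"
    and le: "\<And>\<phi> :: 'a \<Rightarrow> real. continuous_on UNIV \<phi> \<Longrightarrow> (\<And>x. 0 \<le> \<phi> x) \<Longrightarrow> (\<And>x. \<phi> x \<le> 1) \<Longrightarrow>
       (LINT x|A. \<phi> x) \<le> (LINT x|B. \<phi> x)"
  shows "A = B"
proof -
  interpret A: prob_space A by fact
  interpret B: prob_space B by fact
  note [measurable_cong] = sA sB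
  have int: "integrable A \<phi>" "integrable B \<phi>" 
    if "continuous_on UNIV \<phi>" "\<And>x. 0 \<le> \<phi> x" "\<And>x. \<phi> x \<le> 1" for \<phi> :: "'a \<Rightarrow> real"
  proof -
    have [measurable]: "\<phi> \<in> borel_measurable borel" by (rule borel_measurable_continuous_onI) fact
    show "integrable A \<phi>" "integrable B \<phi>" using that
      by (auto intro!: A.integrable_const_bound[where B=1] B.integrable_const_bound[where B=1])
  qed
  have eq: "(\<integral>\<^sup>+x. ennreal (\<phi> x) \<partial>A) = (\<integral>\<^sup>+x. ennreal (\<phi> x) \<partial>B)"
    if \<phi>: "continuous_on UNIV \<phi>" "\<And>x. 0 \<le> \<phi> x" "\<And>x. \<phi> x \<le> 1" for \<phi>
  proof -
    have "(LINT x|A. 1 - \<phi> x) \<le> (LINT x|B. 1 - \<phi> x)"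
      by (rule le) (auto intro!: continuous_intros simp: \<phi>)
    then have "(LINT x|A. \<phi> x) = (LINT x|B. \<phi> x)"
      using le[OF \<phi>] int[OF \<phi>] by (simp add: A.prob_space B.prob_space)
    then show ?thesis using int[OF \<phi>] \<phi>(2) by (simp add: nn_integral_eq_integral)
  qed
  have "emeasure A U = emeasure B U" if "open U" for U
  proof (cases "U = UNIV")
    case True
    then show ?thesis using A.emeasure_space_1 B.emeasure_space_1 sets_eq_imp_space_eq[OF sA] sets_eq_imp_space_eq[OF sB] by simp
  next
    case False
    \<comment> \<open>Continuous functions that increase to the indicator of \<open>U\<close>. The case \<open>U = UNIV\<close> is separate
      because the distance to the empty set is 0 by convention.\<close>
    define \<phi> where "\<phi> k x = min 1 (real k * infdist x (- U))" for k x
    have c: "continuous_on UNIV (\<phi> k)" for k unfolding \<phi>_def by (intro continuous_intros)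
    have [measurable]: "\<phi> k \<in> borel_measurable borel" for k
      by (rule borel_measurable_continuous_onI) (rule c)
    have inc: "incseq (\<lambda>k x. ennreal (\<phi> k x))"
      by (intro incseq_SucI le_funI ennreal_leI) (auto simp: \<phi>_def min_def infdist_nonneg mult_right_mono intro: order_trans)
    have lim: "(SUP k. ennreal (\<phi> k x)) = indicator U x" for x
    proof (cases "x \<in> U")
      case True
      then have pos: "0 < infdist x (- U)"
        using \<open>open U\<close> False by (intro infdist_pos_not_in_closed) auto
      obtain k where "1 / infdist x (- U) < real k" using reals_Archimedean2 by blast
      then have "\<phi> k x = 1" using pos by (auto simp: \<phi>_def field_simps min_def)
      moreover have "ennreal (\<phi> j x) \<le> 1" for j by (simp add: \<phi>_def)
      ultimately show ?thesis using True 
        by (intro antisym SUP_least SUP_upper2[of k]) auto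
    next
      case False
      then show ?thesis by (simp add: \<phi>_def)
    qed
    have "emeasure A U = (\<integral>\<^sup>+x. (SUP k. ennreal (\<phi> k x)) \<partial>A)"
      using that by (simp add: lim sA)
    also have "\<dots> = (SUP k. \<integral>\<^sup>+x. ennreal (\<phi> k x) \<partial>A)"
      by (rule nn_integral_monotone_convergence_SUP[OF inc]) auto
    also have "\<dots> = (SUP k. \<integral>\<^sup>+x. ennreal (\<phi> k x) \<partial>B)"
      by (subst eq[OF c]) (auto simp: \<phi>_def infdist_nonneg)
    also have "\<dots> = (\<integral>\<^sup>+x. (SUP k. ennreal (\<phi> k x)) \<partial>B)"
      by (rule nn_integral_monotone_convergence_SUP[OF inc, symmetric]) auto
    also have "\<dots> = emeasure B U"
      using that by (simp add: lim sB)
    finally show ?thesis .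
  qed
  then show ?thesis
    by (intro measure_eqI_generator_eq[where E="{U. open U}" and \<Omega>=UNIV and A="\<lambda>_. UNIV"])
       (auto simp: Int_stable_def sA sB sets_borel)
qed

lemma continuous_on_integral_param:
  fixes F :: "'a::metric_space \<Rightarrow> 'm \<Rightarrow> real"
  assumes "prob_space M" and [measurable]: "\<And>x. F x \<in> borel_measurable M"
    and B: "\<And>x y. \<bar>F x y\<bar> \<le> B" and c: "\<And>y. y \<in> space M \<Longrightarrow> continuous_on UNIV (\<lambda>x. F x y)"
  shows "continuous_on UNIV (\<lambda>x. LINT y|M. F x y)"
proof (rule continuous_on_sequentiallyI)
  interpret prob_space M by fact
  fix u a assume u: "u \<longlonglongrightarrow> (a::'a)"
  show "(\<lambda>n. LINT y|M. F (u n) y) \<longlonglongrightarrow> (LINT y|M. F a y)"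
  proof (rule integral_dominated_convergence[where w="\<lambda>_. B"])
    show "AE y in M. (\<lambda>n. F (u n) y) \<longlonglongrightarrow> F a y"
      by (intro AE_I2 continuous_on_tendsto_compose[OF c u]) auto
  qed (use B in auto)
qed

section \<open>Gain operators and Wild sums\<close>

definition borel_probs :: "'a::topological_space measure set" where
  "borel_probs = {m. prob_space m \<and> sets m = sets borel}"

lemma borel_probsD: "m \<in> borel_probs \<Longrightarrow> prob_space m" "m \<in> borel_probs \<Longrightarrow> sets m = sets borel"
  "m \<in> borel_probs \<Longrightarrow> space m = UNIV"
  by (auto simp: borel_probs_def dest: sets_eq_imp_space_eq)

lemma pmf_kernel:
  assumes "\<And>x. K x \<in> borel_probs"
  shows "K \<in> measurable (measure_pmf P) (subprob_algebra borel)"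
  using assms by (auto simp: space_subprob_algebra borel_probs_def prob_space_imp_subprob_space)

lemma bind_pmf_borel_probs:
  assumes "\<And>x. K x \<in> borel_probs"
  shows "measure_pmf P \<bind> K \<in> borel_probs"
  unfolding borel_probs_def
proof safe
  show "prob_space (measure_pmf P \<bind> K)"
    by (rule measure_pmf.prob_space_bind[OF _ pmf_kernel[OF assms]]) (simp add: assms borel_probsD)
qed (use assms in \<open>auto simp: sets_bind[of _ _ borel] borel_probsD\<close>)

lemma nn_integral_bind_pmf_kernel:
  assumes "\<And>x. K x \<in> borel_probs" "g \<in> borel_measurable borel"
  shows "(\<integral>\<^sup>+x. g x \<partial>(measure_pmf P \<bind> K)) = (\<integral>\<^sup>+x. \<integral>\<^sup>+y. g y \<partial>K x \<partial>measure_pmf P)"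
  by (rule nn_integral_bind[OF assms(2) pmf_kernel[OF assms(1)]])

text \<open>
  The gain term of a Boltzmann equation with collision rule \<open>T\<close>: two independent particles collide, with
  an independent random parameter of law \<open>N\<close>.
\<close>
definition gain :: "('a \<Rightarrow> 'a \<Rightarrow> 'p \<Rightarrow> 'a) \<Rightarrow> 'p measure \<Rightarrow> 'a measure \<Rightarrow> 'a measure \<Rightarrow> 'a::topological_space measure" where
  "gain T N m m' = distr (m \<Otimes>\<^sub>M (m' \<Otimes>\<^sub>M N)) borel (\<lambda>(v, w, p). T v w p)"

text \<open>
  The terms of the Wild sum: the term with index \<open>n\<close> is the law of a particle whose collision history has \<open>n\<close>
  collisions. In a history with \<open>Suc n\<close> collisions, the last one joins two histories with \<open>k\<close> and
  \<open>n - k\<close> collisions, \<open>k\<close> being uniform. The minimum \<open>min k n\<close> equals \<open>k\<close> on the support of \<open>k\<close>; it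
  makes the recursion terminate for every value of the bound variable.
\<close>
fun wild :: "('a \<Rightarrow> 'a \<Rightarrow> 'p \<Rightarrow> 'a) \<Rightarrow> 'p measure \<Rightarrow> 'a measure \<Rightarrow> nat \<Rightarrow> 'a::topological_space measure" where
  "wild T N m 0 = m"
| "wild T N m (Suc n) = measure_pmf (pmf_of_set {..n}) \<bind> (\<lambda>k. gain T N (wild T N m (min k n)) (wild T N m (n - k)))"

locale random_binary_map = N: prob_space N for N :: "'p measure" +
  fixes T :: "'a::{metric_space, second_countable_topology} \<Rightarrow> 'a \<Rightarrow> 'p \<Rightarrow> 'a"
  assumes measurable_map: "(\<lambda>(v, w, p). T v w p) \<in> borel \<Otimes>\<^sub>M (borel \<Otimes>\<^sub>M N) \<rightarrow>\<^sub>M borel"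
begin

lemma measurable_T[measurable (raw)]:
  assumes "f \<in> M \<rightarrow>\<^sub>M borel" "g \<in> M \<rightarrow>\<^sub>M borel" "h \<in> M \<rightarrow>\<^sub>M N"
  shows "(\<lambda>x. T (f x) (g x) (h x)) \<in> M \<rightarrow>\<^sub>M borel"
proof -
  have "(\<lambda>x. (f x, g x, h x)) \<in> M \<rightarrow>\<^sub>M borel \<Otimes>\<^sub>M (borel \<Otimes>\<^sub>M N)" using assms by measurable
  from measurable_compose[OF this measurable_map] show ?thesis by simp
qed

lemma gain_borel_probs:
  assumes "m \<in> borel_probs" "m' \<in> borel_probs"
  shows "gain T N m m' \<in> borel_probs"
proof -
  note [measurable_cong] = borel_probsD(2)[OF assms(1)] borel_probsD(2)[OF assms(2)]
  interpret m: prob_space m using assms borel_probsD by blast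
  interpret m': prob_space m' using assms borel_probsD by blast
  interpret p: pair_prob_space m' N ..
  interpret q: pair_prob_space m "m' \<Otimes>\<^sub>M N" ..
  show ?thesis unfolding borel_probs_def gain_def by (auto intro!: q.prob_space_distr)
qed

lemma nn_integral_gain:
  assumes "m \<in> borel_probs" "m' \<in> borel_probs" and [measurable]: "g \<in> borel_measurable borel"
  shows "(\<integral>\<^sup>+x. g x \<partial>gain T N m m') = (\<integral>\<^sup>+v. \<integral>\<^sup>+w. \<integral>\<^sup>+p. g (T v w p) \<partial>N \<partial>m' \<partial>m)"
proof -
  note [measurable_cong] = borel_probsD(2)[OF assms(1)] borel_probsD(2)[OF assms(2)]
  interpret m: prob_space m using assms borel_probsD by blast
  interpret m': prob_space m' using assms borel_probsD by blast
  interpret p: pair_prob_space m' N ..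
  have "(\<integral>\<^sup>+x. g x \<partial>gain T N m m') = (\<integral>\<^sup>+z. g (T (fst z) (fst (snd z)) (snd (snd z))) \<partial>(m \<Otimes>\<^sub>M (m' \<Otimes>\<^sub>M N)))"
    unfolding gain_def by (subst nn_integral_distr) (auto simp: split_beta')
  also have "\<dots> = (\<integral>\<^sup>+v. \<integral>\<^sup>+y. g (T v (fst y) (snd y)) \<partial>(m' \<Otimes>\<^sub>M N) \<partial>m)"
    by (subst p.nn_integral_fst[symmetric]) auto
  also have "\<dots> = (\<integral>\<^sup>+v. \<integral>\<^sup>+w. \<integral>\<^sup>+p. g (T v w p) \<partial>N \<partial>m' \<partial>m)"
    by (subst N.nn_integral_fst[symmetric]) auto
  finally show ?thesis .
qed

lemma wild_borel_probs:
  assumes "m \<in> borel_probs"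
  shows "wild T N m n \<in> borel_probs"
proof (induction n rule: less_induct)
  case (less n)
  then show ?case
    using assms by (cases n) (auto intro!: bind_pmf_borel_probs gain_borel_probs)
qed

lemma nn_integral_wild_Suc:
  assumes "m \<in> borel_probs" "g \<in> borel_measurable borel"
  shows "(\<integral>\<^sup>+x. g x \<partial>wild T N m (Suc n)) = (\<Sum>k\<le>n. \<integral>\<^sup>+x. g x \<partial>gain T N (wild T N m k) (wild T N m (n - k))) / ennreal (real (Suc n))"
  by (simp add: nn_integral_bind_pmf_kernel[OF _ assms(2)] gain_borel_probs wild_borel_probs assms(1) nn_integral_pmf_of_set
     atMost_Suc ennreal_of_nat_eq_real_of_nat del: of_nat_Suc)

text \<open>
  The two factors of a gain have, by induction on the number of collisions, an average cost of at most
  that of \<open>m\<close>, and the weights \<open>\<alpha>\<close> and \<open>\<gamma>\<close> of sum at most 1 preserve this bound.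
\<close>
lemma nn_integral_wild_le:
  assumes m: "m \<in> borel_probs" and c[measurable]: "c \<in> borel_measurable borel"
    and contr: "\<And>v w. (\<integral>\<^sup>+p. c (T v w p) \<partial>N) \<le> \<alpha> * c v + \<gamma> * c w"
    and sum: "\<alpha> + \<gamma> \<le> 1"
  shows "(\<integral>\<^sup>+x. c x \<partial>wild T N m n) \<le> (\<integral>\<^sup>+x. c x \<partial>m)"
proof (induction n rule: less_induct)
  case (less n)
  show ?case
  proof (cases n)
    case (Suc l)
    have gain_le: "(\<integral>\<^sup>+x. c x \<partial>gain T N (wild T N m (min k l)) (wild T N m (l - k))) \<le> (\<integral>\<^sup>+x. c x \<partial>m)" for k
    proof -
      define P Q where "P = wild T N m (min k l)" and "Q = wild T N m (l - k)"
      have P: "P \<in> borel_probs" and Q: "Q \<in> borel_probs" by (simp_all add: P_def Q_def wild_borel_probs m)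
      note [measurable_cong] = borel_probsD(2)[OF P] borel_probsD(2)[OF Q]
      interpret P: prob_space P using P borel_probsD by blast
      interpret Q: prob_space Q using Q borel_probsD by blast
      have "(\<integral>\<^sup>+x. c x \<partial>gain T N P Q) \<le> (\<integral>\<^sup>+v. \<integral>\<^sup>+w. \<alpha> * c v + \<gamma> * c w \<partial>Q \<partial>P)"
        by (subst nn_integral_gain) (auto intro!: nn_integral_mono contr P Q)
      also have "\<dots> = \<alpha> * (\<integral>\<^sup>+v. c v \<partial>P) + \<gamma> * (\<integral>\<^sup>+w. c w \<partial>Q)"
        by (simp add: nn_integral_add nn_integral_cmult P.emeasure_space_1 Q.emeasure_space_1)
      also have "\<dots> \<le> \<alpha> * (\<integral>\<^sup>+v. c v \<partial>m) + \<gamma> * (\<integral>\<^sup>+v. c v \<partial>m)"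
        by (intro add_mono mult_left_mono) (auto simp: P_def Q_def Suc intro!: less)
      also have "\<dots> \<le> 1 * (\<integral>\<^sup>+v. c v \<partial>m)"
        unfolding distrib_right[symmetric] by (intro mult_right_mono sum) auto
      finally show ?thesis by (simp add: P_def Q_def)
    qed
    have "(\<integral>\<^sup>+x. c x \<partial>wild T N m n) =
        (\<integral>\<^sup>+k. (\<integral>\<^sup>+x. c x \<partial>gain T N (wild T N m (min k l)) (wild T N m (l - k))) \<partial>measure_pmf (pmf_of_set {..l}))"
      unfolding Suc wild.simps
      by (rule nn_integral_bind_pmf_kernel) (auto intro!: gain_borel_probs wild_borel_probs m)
    also have "\<dots> \<le> (\<integral>\<^sup>+k. (\<integral>\<^sup>+x. c x \<partial>m) \<partial>measure_pmf (pmf_of_set {..l}))"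
      by (rule nn_integral_mono) (rule gain_le)
    finally show ?thesis by (simp add: measure_pmf.emeasure_space_1)
  qed simp
qed

end

text \<open>
  Gain and Wild sums are natural in the collision rule. For pairs of particles and the projections this
  says that a coupled dynamics has the uncoupled dynamics as its marginals.
\<close>
lemma distr_gain:
  assumes "random_binary_map N T" "random_binary_map N T'"
    and h[measurable]: "h \<in> borel \<rightarrow>\<^sub>M borel" and hT: "\<And>v w p. h (T v w p) = T' (h v) (h w) p"
    and m: "m \<in> borel_probs" and m': "m' \<in> borel_probs"
  shows "distr (gain T N m m') borel h = gain T' N (distr m borel h) (distr m' borel h)"
proof (rule measure_eqI)
  interpret T: random_binary_map N T by fact
  interpret T': random_binary_map N T' by fact
  note [measurable_cong] = borel_probsD(2)[OF m] borel_probsD(2)[OF m']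
  interpret m: prob_space m using m borel_probsD by blast
  interpret m': prob_space m' using m' borel_probsD by blast
  have d: "distr m borel h \<in> borel_probs" "distr m' borel h \<in> borel_probs"
    by (auto simp: borel_probs_def intro!: m.prob_space_distr m'.prob_space_distr)
  have g: "gain T N m m' \<in> borel_probs" by (intro T.gain_borel_probs m m')
  note [measurable_cong] = borel_probsD(2)[OF g]
  fix A assume "A \<in> sets (distr (gain T N m m') borel h)"
  then have [measurable]: "A \<in> sets borel" by simp
  interpret d': prob_space "distr m' borel h" by (rule m'.prob_space_distr) simp
  have "emeasure (distr (gain T N m m') borel h) A = (\<integral>\<^sup>+x. indicator A (h x) \<partial>gain T N m m')"
    by (subst nn_integral_indicator[symmetric], simp, subst nn_integral_distr) auto
  also have "\<dots> = (\<integral>\<^sup>+v. \<integral>\<^sup>+w. \<integral>\<^sup>+p. indicator A (T' (h v) (h w) p) \<partial>N \<partial>m' \<partial>m)"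
    by (subst T.nn_integral_gain) (auto simp: m m' hT)
  also have "\<dots> = (\<integral>\<^sup>+v. \<integral>\<^sup>+w. \<integral>\<^sup>+p. indicator A (T' (h v) w p) \<partial>N \<partial>distr m' borel h \<partial>m)"
    by (subst nn_integral_distr) auto
  also have "\<dots> = (\<integral>\<^sup>+v. \<integral>\<^sup>+w. \<integral>\<^sup>+p. indicator A (T' v w p) \<partial>N \<partial>distr m' borel h \<partial>distr m borel h)"
    by (subst (2) nn_integral_distr) auto
  also have "\<dots> = (\<integral>\<^sup>+x. indicator A x \<partial>gain T' N (distr m borel h) (distr m' borel h))"
    by (subst T'.nn_integral_gain) (auto simp: d)
  also have "\<dots> = emeasure (gain T' N (distr m borel h) (distr m' borel h)) A"
    using borel_probsD(2)[OF T'.gain_borel_probs[OF d]] by simp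
  finally show "emeasure (distr (gain T N m m') borel h) A = emeasure (gain T' N (distr m borel h) (distr m' borel h)) A" .
qed (simp add: gain_def)

lemma distr_wild:
  assumes "random_binary_map N T" "random_binary_map N T'"
    and h[measurable]: "h \<in> borel \<rightarrow>\<^sub>M borel" and hT: "\<And>v w p. h (T v w p) = T' (h v) (h w) p"
    and m: "m \<in> borel_probs"
  shows "distr (wild T N m n) borel h = wild T' N (distr m borel h) n"
proof (induction n rule: less_induct)
  case (less n)
  interpret T: random_binary_map N T by fact
  show ?case
  proof (cases n)
    case (Suc l)
    let ?P = "measure_pmf (pmf_of_set {..l})"
    let ?K = "\<lambda>k. gain T N (wild T N m (min k l)) (wild T N m (l - k))"
    have K: "distr (?K k) borel h =
        gain T' N (wild T' N (distr m borel h) (min k l)) (wild T' N (distr m borel h) (l - k))" for k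
    proof -
      have "distr (?K k) borel h =
          gain T' N (distr (wild T N m (min k l)) borel h) (distr (wild T N m (l - k)) borel h)"
        by (rule distr_gain) (simp_all add: assms T.wild_borel_probs)
      then show ?thesis by (simp add: less Suc)
    qed
    have "distr (?P \<bind> ?K) borel h = ?P \<bind> (\<lambda>k. distr (?K k) borel h)"
      by (rule distr_bind[OF pmf_kernel]) (simp_all add: T.gain_borel_probs T.wild_borel_probs m)
    then show ?thesis unfolding Suc wild.simps K .
  qed simp
qed

section \<open>Solutions are Wild sums\<close>

context random_binary_map
begin

lemma integral_gain:
  fixes \<phi> :: "'a \<Rightarrow> real"
  assumes "m \<in> borel_probs" "m' \<in> borel_probs" and [measurable]: "\<phi> \<in> borel_measurable borel"
    and B: "\<And>x. \<bar>\<phi> x\<bar> \<le> B"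
  shows "(LINT x|gain T N m m'. \<phi> x) = (LINT v|m. LINT w|m'. LINT p|N. \<phi> (T v w p))"
proof -
  note [measurable_cong] = borel_probsD(2)[OF assms(1)] borel_probsD(2)[OF assms(2)]
  interpret m: prob_space m using assms borel_probsD by blast
  interpret m': prob_space m' using assms borel_probsD by blast
  interpret p: pair_prob_space m' N ..
  interpret q: pair_prob_space m "m' \<Otimes>\<^sub>M N" ..
  have "(LINT x|gain T N m m'. \<phi> x) = (LINT z|(m \<Otimes>\<^sub>M (m' \<Otimes>\<^sub>M N)). \<phi> (T (fst z) (fst (snd z)) (snd (snd z))))"
    unfolding gain_def by (subst integral_distr) (auto simp: split_beta')
  also have "\<dots> = (LINT v|m. LINT y|(m' \<Otimes>\<^sub>M N). \<phi> (T v (fst y) (snd y)))"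
    by (subst q.integral_fst'[symmetric]) (auto intro!: q.integrable_const_bound[where B=B] B)
  also have "\<dots> = (LINT v|m. LINT w|m'. LINT p|N. \<phi> (T v w p))"
    by (subst p.integral_fst'[symmetric]) (auto intro!: p.integrable_const_bound[where B=B] B)
  finally show ?thesis .
qed

lemma integral_wild_Suc:
  fixes \<phi> :: "'a \<Rightarrow> real"
  assumes m: "m \<in> borel_probs" and [measurable]: "\<phi> \<in> borel_measurable borel"
    and \<phi>: "\<And>x. 0 \<le> \<phi> x" "\<And>x. \<phi> x \<le> 1"
  shows "(LINT x|wild T N m (Suc n). \<phi> x) * real (Suc n) =
    (\<Sum>k\<le>n. LINT x|gain T N (wild T N m k) (wild T N m (n - k)). \<phi> x)"
proof -
  have eq: "(\<integral>\<^sup>+x. ennreal (\<phi> x) \<partial>P) = ennreal (LINT x|P. \<phi> x)" if P: "P \<in> borel_probs" for P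
  proof -
    interpret prob_space P using P borel_probsD by blast
    note [measurable_cong] = borel_probsD(2)[OF P]
    show ?thesis using \<phi> by (intro nn_integral_eq_integral integrable_const_bound[where B=1]) auto
  qed
  have nn: "0 \<le> (LINT x|P. \<phi> x)" for P using \<phi> by simp
  have "ennreal (LINT x|wild T N m (Suc n). \<phi> x) =
      ennreal (\<Sum>k\<le>n. LINT x|gain T N (wild T N m k) (wild T N m (n - k)). \<phi> x) / ennreal (real (Suc n))"
    using nn_integral_wild_Suc[OF m, of \<phi> n]
    by (simp add: eq wild_borel_probs gain_borel_probs m sum_ennreal nn del: wild.simps of_nat_Suc)
  also have "\<dots> = ennreal ((\<Sum>k\<le>n. LINT x|gain T N (wild T N m k) (wild T N m (n - k)). \<phi> x) / real (Suc n))"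
    by (intro divide_ennreal sum_nonneg nn) simp
  finally show ?thesis
    by (subst (asm) ennreal_inj) (auto simp: nn sum_nonneg field_simps simp del: wild.simps)
qed

text \<open>
  The gain operator is monotone in the sense of nonnegative continuous test functions, so a lower bound
  of \<open>F\<close> by a combination of the \<open>Q n\<close> can be inserted in both arguments. Of the resulting double sum
  over indices below \<open>K\<close>, only the triangle of index sums below \<open>K\<close> is kept; it is what one more
  term of the Wild sum needs. Both insertions test against functions of one variable that result from
  integrating the other variables; continuity of the collision rule makes these functions continuous.
\<close>
lemma gain_lower_bound:
  fixes \<phi> :: "'a \<Rightarrow> real" and a :: "nat \<Rightarrow> real"
  assumes cont: "\<And>p. p \<in> space N \<Longrightarrow> continuous_on UNIV (\<lambda>z. T (fst z) (snd z) p)"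
    and F: "F \<in> borel_probs" and Q: "\<And>n. Q n \<in> borel_probs" and a: "\<And>n. 0 \<le> a n"
    and le: "\<And>\<phi> :: 'a \<Rightarrow> real. continuous_on UNIV \<phi> \<Longrightarrow> (\<And>x. 0 \<le> \<phi> x) \<Longrightarrow> (\<And>x. \<phi> x \<le> 1) \<Longrightarrow>
       (\<Sum>n<K. a n * (LINT x|Q n. \<phi> x)) \<le> (LINT x|F. \<phi> x)"
    and \<phi>: "continuous_on UNIV \<phi>" "\<And>x. 0 \<le> \<phi> x" "\<And>x. \<phi> x \<le> 1"
  shows "(\<Sum>n<K. \<Sum>j\<le>n. a j * a (n - j) * (LINT x|gain T N (Q j) (Q (n - j)). \<phi> x)) \<le> (LINT x|gain T N F F. \<phi> x)"
proof -
  have [measurable]: "\<phi> \<in> borel_measurable borel" by (rule borel_measurable_continuous_onI) (rule \<phi>)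
  define \<Psi> where "\<Psi> v w = (LINT p|N. \<phi> (T v w p))" for v w
  have bound: "0 \<le> (LINT x|P. g x)" "(LINT x|P. g x) \<le> 1" 
    if "prob_space P" "g \<in> borel_measurable P" "\<And>x. 0 \<le> g x" "\<And>x. g x \<le> 1" for P and g :: "'b \<Rightarrow> real"
  proof -
    interpret prob_space P by fact
    have "integrable P g" using that by (intro integrable_const_bound[where B=1]) auto
    then show "0 \<le> (LINT x|P. g x)" "(LINT x|P. g x) \<le> 1"
      using that by (auto intro!: integral_le_const)
  qed
  have \<Psi>01: "0 \<le> \<Psi> v w" "\<Psi> v w \<le> 1" for v w
    unfolding \<Psi>_def using \<phi> by (auto intro!: bound N.prob_space_axioms)
  have contT: "continuous_on UNIV (\<lambda>v. T v w p)" "continuous_on UNIV (\<lambda>w. T v w p)" if "p \<in> space N" for v w p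
  proof -
    have "continuous_on UNIV (\<lambda>v. (v, w))" "continuous_on UNIV (\<lambda>w. (v, w))"
      by (auto intro!: continuous_on_Pair)
    then show "continuous_on UNIV (\<lambda>v. T v w p)" "continuous_on UNIV (\<lambda>w. T v w p)"
      using continuous_on_compose2[OF cont[OF that], of UNIV "\<lambda>v. (v, w)"]
        continuous_on_compose2[OF cont[OF that], of UNIV "\<lambda>w. (v, w)"] by simp_all
  qed
  have \<Psi>w: "continuous_on UNIV (\<lambda>w. \<Psi> v w)" for v
    unfolding \<Psi>_def
    by (rule continuous_on_integral_param[OF N.prob_space_axioms, where B=1])
       (use \<phi> contT in \<open>auto intro: continuous_on_compose2[OF \<phi>(1)]\<close>)
  have \<Psi>v: "continuous_on UNIV (\<lambda>v. \<Psi> v w)" for w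
    unfolding \<Psi>_def
    by (rule continuous_on_integral_param[OF N.prob_space_axioms, where B=1])
       (use \<phi> contT in \<open>auto intro: continuous_on_compose2[OF \<phi>(1)]\<close>)
  have [measurable]: "\<Psi> v \<in> borel_measurable borel" for v
    by (rule borel_measurable_continuous_onI) (rule \<Psi>w)
  have \<Psi>Q: "continuous_on UNIV (\<lambda>v. LINT w|P. \<Psi> v w)" if P: "P \<in> borel_probs" for P
  proof (rule continuous_on_integral_param[where B=1])
    note [measurable_cong] = borel_probsD(2)[OF P]
    show "\<Psi> v \<in> borel_measurable P" for v by measurable
  qed (use \<Psi>01 \<Psi>v P borel_probsD in auto)
  have \<Psi>Q01: "0 \<le> (LINT w|P. \<Psi> v w)" "(LINT w|P. \<Psi> v w) \<le> 1" if P: "P \<in> borel_probs" for P v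
  proof -
    note [measurable_cong] = borel_probsD(2)[OF P]
    show "0 \<le> (LINT w|P. \<Psi> v w)" "(LINT w|P. \<Psi> v w) \<le> 1"
      using P \<Psi>01 by (auto intro!: bound borel_probsD)
  qed
  have gain: "(LINT x|gain T N P P'. \<phi> x) = (LINT v|P. LINT w|P'. \<Psi> v w)" if "P \<in> borel_probs" "P' \<in> borel_probs" for P P'
    unfolding \<Psi>_def using \<phi> that by (intro integral_gain[where B=1]) auto
  interpret F: prob_space F using F borel_probsD by blast
  note [measurable_cong] = borel_probsD(2)[OF F]
  have int: "integrable F (\<lambda>v. LINT w|P. \<Psi> v w)" if P: "P \<in> borel_probs" for P
  proof (rule F.integrable_const_bound[where B=1])
    show "(\<lambda>v. LINT w|P. \<Psi> v w) \<in> borel_measurable F"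
      using borel_measurable_continuous_onI[OF \<Psi>Q[OF P]] by measurable
  qed (use \<Psi>Q01[OF P] in auto)
  have "(\<Sum>n<K. \<Sum>j\<le>n. a j * a (n - j) * (LINT x|gain T N (Q j) (Q (n - j)). \<phi> x)) =
      (\<Sum>(j,k)\<in>{(j,k). j + k < K}. a j * a k * (LINT x|gain T N (Q j) (Q k). \<phi> x))"
    by (rule sum.triangle_reindex[symmetric])
  also have "\<dots> \<le> (\<Sum>(j,k)\<in>{..<K} \<times> {..<K}. a j * a k * (LINT x|gain T N (Q j) (Q k). \<phi> x))"
    using \<phi> a by (intro sum_mono2) auto
  also have "\<dots> = (\<Sum>k<K. a k * (\<Sum>j<K. a j * (LINT v|Q j. LINT w|Q k. \<Psi> v w)))"
    by (subst sum.cartesian_product[symmetric], subst sum.swap)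
       (simp add: gain Q sum_distrib_left mult_ac)
  also have "\<dots> \<le> (\<Sum>k<K. a k * (LINT v|F. LINT w|Q k. \<Psi> v w))"
    by (intro sum_mono mult_left_mono le a \<Psi>Q \<Psi>Q01 Q)
  also have "\<dots> = (LINT v|F. (\<Sum>k<K. a k * (LINT w|Q k. \<Psi> v w)))"
    by (subst Bochner_Integration.integral_sum) (auto intro!: int Q)
  also have "\<dots> \<le> (LINT v|F. LINT w|F. \<Psi> v w)"
    by (intro integral_mono Bochner_Integration.integrable_sum integrable_mult_right int Q F le \<Psi>w \<Psi>01)
  also have "\<dots> = (LINT x|gain T N F F. \<phi> x)" by (simp add: gain F)
  finally show ?thesis .
qed

text \<open>
  Every solution dominates the partial sums of the Wild sum. By the equation, \<open>exp t\<close> times the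
  integral of \<open>\<phi>\<close> against \<open>f t\<close> has the derivative \<open>exp t\<close> times the integral of \<open>\<phi>\<close> against the
  gain. If \<open>f t\<close> dominates the first \<open>K\<close> terms for all \<open>t\<close>, then by \<open>gain_lower_bound\<close> this derivative dominates
  the derivative of the sum of \<open>(1 - exp (- t)) ^ n * q n\<close> over \<open>n \<le> K\<close>, where \<open>q n\<close> is the integral of
  \<open>\<phi>\<close> against the Wild term \<open>n\<close>, and integration in time gives the bound for \<open>K + 1\<close> terms.
\<close>
lemma weak_solution_lower_bound:
  fixes f :: "real \<Rightarrow> 'a measure"
  assumes cont: "\<And>p. p \<in> space N \<Longrightarrow> continuous_on UNIV (\<lambda>z. T (fst z) (snd z) p)"
    and f: "\<And>t. 0 \<le> t \<Longrightarrow> f t \<in> borel_probs"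
    and deriv: "\<And>\<phi> t. continuous_on UNIV \<phi> \<Longrightarrow> bounded (range \<phi>) \<Longrightarrow> 0 \<le> t \<Longrightarrow>
      ((\<lambda>s. LINT v|f s. \<phi> v) has_real_derivative (LINT x|gain T N (f t) (f t). \<phi> x) - (LINT v|f t. \<phi> v)) (at t within {0..})"
    and "0 \<le> t" and "continuous_on UNIV \<phi>" "\<And>x. 0 \<le> \<phi> x" "\<And>x. \<phi> x \<le> (1::real)"
  shows "(\<Sum>n<K. exp (- t) * (1 - exp (- t)) ^ n * (LINT x|wild T N (f 0) n. \<phi> x)) \<le> (LINT x|f t. \<phi> x)"
  using assms(4-)
proof (induction K arbitrary: t \<phi>)
  case 0
  then show ?case by simp
next
  case (Suc K)
  define q where "q n = (LINT x|wild T N (f 0) n. \<phi> x)" for n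
  define h where "h s = exp s * (LINT x|f s. \<phi> x) - (\<Sum>n<Suc K. (1 - exp (- s)) ^ n * q n)" for s
  have [measurable]: "\<phi> \<in> borel_measurable borel" by (rule borel_measurable_continuous_onI) (rule Suc)
  have bdd: "bounded (range \<phi>)" using Suc(4,5) by (intro boundedI[where B=1]) auto
  define h' where "h' s = exp s * (LINT x|gain T N (f s) (f s). \<phi> x) - 
      (\<Sum>n<K. real (Suc n) * (1 - exp (- s)) ^ n * exp (- s) * q (Suc n))" for s
  have power_deriv: "((\<lambda>s. (1 - exp (- s)) ^ Suc n * q (Suc n)) has_real_derivative
      real (Suc n) * (1 - exp (- s)) ^ n * exp (- s) * q (Suc n)) (at s within S)" for n s S
    by (rule derivative_eq_intros refl)+ simp
  have h': "(h has_real_derivative h' s) (at s within {0..})" if "0 \<le> s" for s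
    unfolding h_def[abs_def] h'_def
    by (subst sum.lessThan_Suc_shift)
       (auto intro!: derivative_eq_intros deriv Suc bdd that power_deriv simp: algebra_simps simp del: power_Suc of_nat_Suc)
  have h'_nonneg: "0 \<le> h' s" if s: "0 \<le> s" for s
  proof -
    define a where "a n = exp (- s) * (1 - exp (- s)) ^ n" for n
    \<comment> \<open>All histories with \<open>n + 1\<close> collisions carry the same weight, so their gains add up to a
      multiple of the next Wild term.\<close>
    have same_weight: "(\<Sum>j\<le>n. a j * a (n - j) * (LINT x|gain T N (wild T N (f 0) j) (wild T N (f 0) (n - j)). \<phi> x))
        = exp (- s) * (real (Suc n) * (1 - exp (- s)) ^ n * exp (- s) * q (Suc n))" for n
    proof -
      have "a j * a (n - j) = (exp (- s))\<^sup>2 * (1 - exp (- s)) ^ n" if "j \<le> n" for j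
        using that by (simp add: a_def power2_eq_square mult_ac flip: power_add)
      then show ?thesis
        using integral_wild_Suc[OF f[of 0], of \<phi> n] Suc
        by (simp add: q_def sum_distrib_left[symmetric] power2_eq_square mult_ac del: wild.simps of_nat_Suc)
    qed
    have "(\<Sum>n<K. \<Sum>j\<le>n. a j * a (n - j) * (LINT x|gain T N (wild T N (f 0) j) (wild T N (f 0) (n - j)). \<phi> x))
       \<le> (LINT x|gain T N (f s) (f s). \<phi> x)"
      by (rule gain_lower_bound[OF cont])
         (use Suc s in \<open>auto intro!: f wild_borel_probs simp: a_def\<close>)
    then have "exp s * (\<Sum>n<K. exp (- s) * (real (Suc n) * (1 - exp (- s)) ^ n * exp (- s) * q (Suc n))) \<le>
       exp s * (LINT x|gain T N (f s) (f s). \<phi> x)"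
      unfolding same_weight by (intro mult_left_mono) auto
    moreover have "exp s * (exp (- s) * x) = x" for x
      by (simp add: mult.assoc[symmetric] flip: exp_add)
    ultimately show ?thesis
      unfolding h'_def sum_distrib_left[symmetric] by simp
  qed
  have "h 0 \<le> h t"
  proof (rule DERIV_nonneg_imp_increasing_open[OF \<open>0 \<le> t\<close>])
    fix x assume x: "0 < x" "x < t"
    have "at x within {0..} = at x" using x by (intro at_within_open_subset[of _ "{0<..}"]) auto
    with h'[of x] h'_nonneg[of x] x show "\<exists>y. DERIV h x :> y \<and> 0 \<le> y" by auto
  next
    have "continuous_on {0..} h" by (rule DERIV_continuous_on[where D=h']) (use h' in auto)
    then show "continuous_on {0..t} h" by (rule continuous_on_subset) auto
  qed
  moreover have "h 0 = 0" unfolding h_def q_def sum.lessThan_Suc_shift by simp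
  ultimately have "exp (- t) * (\<Sum>n<Suc K. (1 - exp (- t)) ^ n * q n) \<le> exp (- t) * (exp t * (LINT x|f t. \<phi> x))"
    by (intro mult_left_mono) (auto simp: h_def)
  then show ?case
    by (simp add: q_def sum_distrib_left mult.assoc[symmetric] distrib_left exp_minus_inverse del: wild.simps flip: exp_add)
qed

text \<open>
  The weights \<open>exp (- t) * (1 - exp (- t)) ^ n\<close> of the Wild sum have total mass 1, so nothing is
  left between a solution and the Wild sum that it dominates. In particular the solution is unique.
\<close>
lemma weak_solution_eq_wild_sum:
  fixes f :: "real \<Rightarrow> 'a measure"
  assumes cont: "\<And>p. p \<in> space N \<Longrightarrow> continuous_on UNIV (\<lambda>z. T (fst z) (snd z) p)"
    and f: "\<And>t. 0 \<le> t \<Longrightarrow> f t \<in> borel_probs"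
    and deriv: "\<And>\<phi> t. continuous_on UNIV \<phi> \<Longrightarrow> bounded (range \<phi>) \<Longrightarrow> 0 \<le> t \<Longrightarrow>
      ((\<lambda>s. LINT v|f s. \<phi> v) has_real_derivative (LINT x|gain T N (f t) (f t). \<phi> x) - (LINT v|f t. \<phi> v)) (at t within {0..})"
    and t: "0 \<le> t"
  shows "f t = measure_pmf (geometric_pmf (exp (- t))) \<bind> wild T N (f 0)"
proof -
  let ?B = "measure_pmf (geometric_pmf (exp (- t))) \<bind> wild T N (f 0)"
  have W: "wild T N (f 0) n \<in> borel_probs" for n by (intro wild_borel_probs f) simp
  have B: "?B \<in> borel_probs" by (intro bind_pmf_borel_probs W)
  have "?B = f t"
  proof (rule measure_eq_if_continuous_integrals_le)
    fix \<phi> :: "'a \<Rightarrow> real" assume \<phi>: "continuous_on UNIV \<phi>" "\<And>x. 0 \<le> \<phi> x" "\<And>x. \<phi> x \<le> 1"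
    have [measurable]: "\<phi> \<in> borel_measurable borel" by (rule borel_measurable_continuous_onI) (rule \<phi>)
    have eq: "(\<integral>\<^sup>+x. ennreal (\<phi> x) \<partial>P) = ennreal (LINT x|P. \<phi> x)" if P: "P \<in> borel_probs" for P
    proof -
      interpret prob_space P using P borel_probsD by blast
      note [measurable_cong] = borel_probsD(2)[OF P]
      show ?thesis using \<phi> by (intro nn_integral_eq_integral integrable_const_bound[where B=1]) auto
    qed
    have nn: "0 \<le> (LINT x|P. \<phi> x)" for P using \<phi> by simp
    have "ennreal (LINT x|?B. \<phi> x) = (\<integral>\<^sup>+n. ennreal (LINT x|wild T N (f 0) n. \<phi> x) \<partial>measure_pmf (geometric_pmf (exp (- t))))"
      by (simp add: eq[symmetric] B W nn_integral_bind_pmf_kernel)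
    also have "\<dots> = (\<Sum>n. ennreal (exp (- t) * (1 - exp (- t)) ^ n * (LINT x|wild T N (f 0) n. \<phi> x)))"
      using t by (simp add: nn_integral_measure_pmf nn_integral_count_space_nat nn mult_ac flip: ennreal_mult)
    also have "\<dots> \<le> ennreal (LINT x|f t. \<phi> x)"
      unfolding suminf_eq_SUP
    proof (rule SUP_least)
      fix K
      have "(\<Sum>n<K. ennreal (exp (- t) * (1 - exp (- t)) ^ n * (LINT x|wild T N (f 0) n. \<phi> x))) =
        ennreal (\<Sum>n<K. exp (- t) * (1 - exp (- t)) ^ n * (LINT x|wild T N (f 0) n. \<phi> x))"
        using t by (intro sum_ennreal mult_nonneg_nonneg nn zero_le_power) auto
      also have "\<dots> \<le> ennreal (LINT x|f t. \<phi> x)"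
        by (intro ennreal_leI weak_solution_lower_bound cont f deriv t \<phi>)
      finally show "(\<Sum>n<K. ennreal (exp (- t) * (1 - exp (- t)) ^ n * (LINT x|wild T N (f 0) n. \<phi> x))) \<le> ennreal (LINT x|f t. \<phi> x)" .
    qed
    finally show "(LINT x|?B. \<phi> x) \<le> (LINT x|f t. \<phi> x)"
      by (subst (asm) ennreal_le_iff) (auto simp: nn)
  qed (use B f[OF t] borel_probsD in auto)
  then show ?thesis by simp
qed

end

section \<open>The collision operator as a gain operator\<close>

definition collide :: "real \<Rightarrow> real^3 \<Rightarrow> real^3 \<Rightarrow> real \<times> (real^3) \<Rightarrow> real^3" where
  "collide e v w p = post_velocity (e + fst p) v w (snd p)"

text \<open>The parameters \<open>\<eta>\<close> and \<open>\<sigma>\<close> are shared: this choice of coupling is what makes distances contract.\<close>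
definition collide_pair ::
    "real \<Rightarrow> (real^3) \<times> (real^3) \<Rightarrow> (real^3) \<times> (real^3) \<Rightarrow> real \<times> (real^3) \<Rightarrow> (real^3) \<times> (real^3)" where
  "collide_pair e y z p = (collide e (fst y) (fst z) p, collide e (snd y) (snd z) p)"

lemma measurable_post_velocity [measurable (raw)]:
  assumes [measurable]: "a \<in> borel_measurable M" "v \<in> borel_measurable M" "w \<in> borel_measurable M" "\<sigma> \<in> borel_measurable M"
  shows "(\<lambda>x. post_velocity (a x) (v x) (w x) (\<sigma> x)) \<in> borel_measurable M"
  unfolding post_velocity_def by measurable

lemma integral_sphere_measure:
  assumes [measurable]: "g \<in> borel_measurable borel"
  shows "(LINT x|sphere_measure. g x) = 4 * pi * (LINT x|sphere_unif. g x :: real)"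
  unfolding sphere_unif_def
  by (subst integral_density) auto

lemma (in prob_space) abs_integral_le_const:
  fixes g :: "'a \<Rightarrow> real"
  assumes "0 \<le> B" "\<And>x. \<bar>g x\<bar> \<le> B"
  shows "\<bar>LINT x|M. g x\<bar> \<le> B"
proof (cases "integrable M g")
  case True
  have "\<bar>LINT x|M. g x\<bar> \<le> (LINT x|M. \<bar>g x\<bar>)" by (rule integral_abs_bound)
  also have "\<dots> \<le> B" using True assms by (intro integral_le_const) auto
  finally show ?thesis .
qed (simp add: not_integrable_integral_eq assms)

lemma random_binary_map_collide:
  assumes "prob_space \<mu>" "sets \<mu> = sets borel"
  shows "random_binary_map (\<mu> \<Otimes>\<^sub>M sphere_unif) (collide e)"
    and "random_binary_map (\<mu> \<Otimes>\<^sub>M sphere_unif) (collide_pair e)"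
proof -
  interpret M: prob_space \<mu> by fact
  interpret S: prob_space sphere_unif by (rule prob_space_sphere_unif)
  interpret P: pair_prob_space \<mu> sphere_unif ..
  note [measurable_cong] = assms(2)
  show 1: "random_binary_map (\<mu> \<Otimes>\<^sub>M sphere_unif) (collide e)"
    by unfold_locales (simp add: collide_def)
  have [measurable]: "fst \<in> borel_measurable (borel :: ((real^3) \<times> (real^3)) measure)"
    "snd \<in> borel_measurable (borel :: ((real^3) \<times> (real^3)) measure)"
    by (auto intro!: borel_measurable_continuous_onI continuous_intros)
  show "random_binary_map (\<mu> \<Otimes>\<^sub>M sphere_unif) (collide_pair e)"
    by unfold_locales (simp add: collide_def collide_pair_def split_beta' borel_measurable_Pair)
qed

text \<open>
  The iterated integrals of the collision operator, with \<open>\<eta>\<close> outermost, are brought into the order of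
  \<open>gain\<close>, with the velocities outside the noise, by Fubini's theorem for bounded functions.
\<close>
lemma collision_op_eq_gain:
  assumes "prob_space \<mu>" "sets \<mu> = sets borel" and f: "f \<in> borel_probs"
    and \<phi>: "continuous_on UNIV \<phi>" "bounded (range \<phi>)"
  shows "collision_op e \<mu> f \<phi> = (LINT x|gain (collide e) (\<mu> \<Otimes>\<^sub>M sphere_unif) f f. \<phi> x) - (LINT v|f. \<phi> v)"
proof -
  interpret M: prob_space \<mu> by fact
  interpret F: prob_space f using f borel_probsD by blast
  interpret S: prob_space sphere_unif by (rule prob_space_sphere_unif)
  interpret MS: pair_prob_space \<mu> sphere_unif ..
  interpret FF: pair_prob_space f f ..
  interpret MF: pair_prob_space \<mu> f ..
  interpret T: random_binary_map "\<mu> \<Otimes>\<^sub>M sphere_unif" "collide e" by (rule random_binary_map_collide) fact+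
  note [measurable_cong] = assms(2) borel_probsD(2)[OF f]
  have [measurable]: "\<phi> \<in> borel_measurable borel" by (rule borel_measurable_continuous_onI) (rule \<phi>)
  obtain B where B: "\<bar>\<phi> x\<bar> \<le> B" for x using \<phi>(2) by (auto simp: bounded_iff)
  have B0: "0 \<le> B" using B[of 0] by linarith
  define G where "G \<eta> v w = (LINT \<sigma>|sphere_unif. \<phi> (post_velocity (e + \<eta>) v w \<sigma>))" for \<eta> v w
  have G [measurable]: "(\<lambda>(\<eta>, v, w). G \<eta> v w) \<in> borel_measurable (borel \<Otimes>\<^sub>M (borel \<Otimes>\<^sub>M borel))"
    unfolding G_def by measurable
  have G' [measurable (raw)]: "(\<lambda>x. G (a x) (b x) (c x)) \<in> borel_measurable M"
    if "a \<in> borel_measurable M" "b \<in> borel_measurable M" "c \<in> borel_measurable M" for a b c and M :: "'z measure"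
    using measurable_compose[OF measurable_Pair[OF that(1) measurable_Pair[OF that(2,3)]] G] by simp
  have GB: "\<bar>G \<eta> v w\<bar> \<le> B" for \<eta> v w
    unfolding G_def by (intro S.abs_integral_le_const B B0)
  have sphere: "(LINT \<sigma>|sphere_measure. \<phi> (post_velocity (e + \<eta>) v w \<sigma>) - \<phi> v) = 4 * pi * (G \<eta> v w - \<phi> v)" for \<eta> v w
  proof -
    have "integrable sphere_unif (\<lambda>\<sigma>. \<phi> (post_velocity (e + \<eta>) v w \<sigma>))"
      by (intro S.integrable_const_bound[where B=B]) (use B in auto)
    then show ?thesis by (simp add: integral_sphere_measure G_def S.prob_space)
  qed
  have intv: "(LINT v|f. G \<eta> v w - \<phi> v) = (LINT v|f. G \<eta> v w) - (LINT v|f. \<phi> v)" for \<eta> w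
    by (intro Bochner_Integration.integral_diff F.integrable_const_bound[where B=B]) (use B GB in auto)
  have intw: "(LINT w|f. (LINT v|f. G \<eta> v w) - (LINT v|f. \<phi> v)) = (LINT w|f. LINT v|f. G \<eta> v w) - (LINT v|f. \<phi> v)" for \<eta>
    by (subst Bochner_Integration.integral_diff)
      (auto intro!: F.integrable_const_bound[where B=B] F.abs_integral_le_const B0 GB simp: F.prob_space)
  have "collision_op e \<mu> f \<phi> = (LINT \<eta>|\<mu>. LINT w|f. LINT v|f. G \<eta> v w - \<phi> v)"
    unfolding collision_op_def sphere by simp
  also have "\<dots> = (LINT \<eta>|\<mu>. LINT w|f. LINT v|f. G \<eta> v w) - (LINT v|f. \<phi> v)"
    unfolding intv intw
    by (subst Bochner_Integration.integral_diff)
      (auto intro!: M.integrable_const_bound[where B=B] F.abs_integral_le_const B0 GB simp: M.prob_space)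
  also have "(LINT \<eta>|\<mu>. LINT w|f. LINT v|f. G \<eta> v w) = (LINT w|f. LINT \<eta>|\<mu>. LINT v|f. G \<eta> v w)"
    by (rule MF.Fubini_integral[symmetric])
      (auto intro!: MF.integrable_const_bound[where B=B] F.abs_integral_le_const B0 GB)
  also have "\<dots> = (LINT w|f. LINT v|f. LINT \<eta>|\<mu>. G \<eta> v w)"
    by (subst MF.Fubini_integral)
      (auto intro!: MF.integrable_const_bound[where B=B] GB)
  also have "\<dots> = (LINT v|f. LINT w|f. LINT \<eta>|\<mu>. G \<eta> v w)"
    by (rule FF.Fubini_integral)
      (auto intro!: FF.integrable_const_bound[where B=B] M.abs_integral_le_const B0 GB)
  also have "\<dots> = (LINT v|f. LINT w|f. LINT p|(\<mu> \<Otimes>\<^sub>M sphere_unif). \<phi> (collide e v w p))"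
    unfolding G_def collide_def
    by (subst MS.integral_fst'[symmetric]) (auto intro!: MS.integrable_const_bound[where B=B] B)
  also have "\<dots> = (LINT x|gain (collide e) (\<mu> \<Otimes>\<^sub>M sphere_unif) f f. \<phi> x)"
    by (rule T.integral_gain[symmetric]) (use f B in auto)
  finally show ?thesis .
qed

lemma is_solution_eq_wild_sum:
  assumes \<mu>: "prob_space \<mu>" "sets \<mu> = sets borel" and sol: "is_solution e \<mu> f0 f" and "0 \<le> t"
  shows "f t = measure_pmf (geometric_pmf (exp (- t))) \<bind> wild (collide e) (\<mu> \<Otimes>\<^sub>M sphere_unif) f0"
proof -
  interpret T: random_binary_map "\<mu> \<Otimes>\<^sub>M sphere_unif" "collide e" by (rule random_binary_map_collide) fact+
  have f: "f t \<in> borel_probs" if "0 \<le> t" for t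
    using sol that by (auto simp: is_solution_def borel_probs_def)
  have "f t = measure_pmf (geometric_pmf (exp (- t))) \<bind> wild (collide e) (\<mu> \<Otimes>\<^sub>M sphere_unif) (f 0)"
  proof (rule T.weak_solution_eq_wild_sum)
    fix \<phi> :: "real^3 \<Rightarrow> real" and t :: real assume "continuous_on UNIV \<phi>" "bounded (range \<phi>)" "0 \<le> t"
    then show "((\<lambda>s. LINT v|f s. \<phi> v) has_real_derivative
        (LINT x|gain (collide e) (\<mu> \<Otimes>\<^sub>M sphere_unif) (f t) (f t). \<phi> x) - (LINT v|f t. \<phi> v)) (at t within {0..})"
      using sol by (simp add: is_solution_def collision_op_eq_gain[OF \<mu> f, symmetric])
  qed (auto intro!: f \<open>0 \<le> t\<close> continuous_intros simp: collide_def post_velocity_def)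
  then show ?thesis using sol by (simp add: is_solution_def)
qed

section \<open>Coupling of two solutions\<close>

lemma ennreal_sqrt_mono: "x \<le> y \<Longrightarrow> ennreal_sqrt x \<le> ennreal_sqrt y"
  by (auto simp: ennreal_sqrt_def top_unique less_top intro!: ennreal_leI enn2real_mono)

text \<open>
  The coupling at time \<open>t\<close> is the Wild sum of the coupled collision rule started from \<open>\<pi>\<close>. Its marginals
  are the Wild sums of the two initial data, hence the two solutions, and its cost is an average of the costs of its
  terms, each of which is at most the cost of \<open>\<pi>\<close>.
\<close>
lemma coupling_of_solutions:
  assumes \<mu>: "prob_space \<mu>" "sets \<mu> = sets borel"
    and m1: "integrable \<mu> (\<lambda>\<eta>. \<eta>)" "(LINT \<eta>|\<mu>. \<eta>) = 0"
    and m2: "integrable \<mu> (\<lambda>\<eta>. \<eta>\<^sup>2)" "(LINT \<eta>|\<mu>. \<eta>\<^sup>2) = 1 - e\<^sup>2"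
    and e: "-1 \<le> e" "e \<le> 3"
    and sol: "is_solution e \<mu> f0 f" "is_solution e \<mu> g0 g" and t: "0 \<le> t"
    and \<pi>: "\<pi> \<in> couplings f0 g0"
  shows "\<exists>\<rho>\<in>couplings (f t) (g t).
    (\<integral>\<^sup>+ p. ennreal ((norm (fst p - snd p))\<^sup>2) \<partial>\<rho>) \<le> (\<integral>\<^sup>+ p. ennreal ((norm (fst p - snd p))\<^sup>2) \<partial>\<pi>)"
proof
  let ?N = "\<mu> \<Otimes>\<^sub>M sphere_unif" and ?P = "measure_pmf (geometric_pmf (exp (- t)))"
  let ?\<rho> = "?P \<bind> wild (collide_pair e) ?N \<pi>"
  let ?c = "\<lambda>p :: (real^3) \<times> (real^3). ennreal ((norm (fst p - snd p))\<^sup>2)"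
  interpret T: random_binary_map ?N "collide_pair e" by (rule random_binary_map_collide(2)[OF \<mu>])
  have \<pi>': "\<pi> \<in> borel_probs" and marg: "distr \<pi> borel fst = f0" "distr \<pi> borel snd = g0"
    using \<pi> unfolding couplings_def borel_probs_def borel_prod mem_Collect_eq by blast+
  have [measurable]: "fst \<in> borel_measurable (borel :: ((real^3) \<times> (real^3)) measure)"
    "snd \<in> borel_measurable (borel :: ((real^3) \<times> (real^3)) measure)"
    by (auto intro!: borel_measurable_continuous_onI continuous_intros)
  have W: "wild (collide_pair e) ?N \<pi> n \<in> borel_probs" for n by (rule T.wild_borel_probs[OF \<pi>'])
  have project: "distr ?\<rho> borel h = ?P \<bind> wild (collide e) ?N (distr \<pi> borel h)"
    if [measurable]: "h \<in> borel \<rightarrow>\<^sub>M borel"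
      and h: "\<And>y z p. h (collide_pair e y z p) = collide e (h y) (h z) p" for h
  proof -
    have "distr ?\<rho> borel h = ?P \<bind> (\<lambda>n. distr (wild (collide_pair e) ?N \<pi> n) borel h)"
      by (rule distr_bind[OF pmf_kernel[OF W]]) auto
    also have "(\<lambda>n. distr (wild (collide_pair e) ?N \<pi> n) borel h) = wild (collide e) ?N (distr \<pi> borel h)"
      by (rule ext, rule distr_wild) (use \<mu> \<pi>' h in \<open>auto intro!: random_binary_map_collide\<close>)
    finally show ?thesis .
  qed
  have \<rho>: "?\<rho> \<in> borel_probs" by (rule bind_pmf_borel_probs[OF W])
  have "distr ?\<rho> borel fst = f t" "distr ?\<rho> borel snd = g t"
    using is_solution_eq_wild_sum[OF \<mu> sol(1) t] is_solution_eq_wild_sum[OF \<mu> sol(2) t]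
    by (simp_all add: project collide_pair_def marg)
  with \<rho> show "?\<rho> \<in> couplings (f t) (g t)"
    unfolding couplings_def borel_probs_def borel_prod mem_Collect_eq by blast
  have "(\<integral>\<^sup>+p. ?c p \<partial>wild (collide_pair e) ?N \<pi> n) \<le> (\<integral>\<^sup>+p. ?c p \<partial>\<pi>)" for n
  proof (rule T.nn_integral_wild_le[OF \<pi>'])
    show "(\<integral>\<^sup>+p. ?c (collide_pair e y z p) \<partial>?N) \<le> ennreal ((3 - e) / 4) * ?c y + ennreal ((1 + e) / 4) * ?c z" for y z
      using post_velocity_contraction[OF \<mu> m1 m2 e, of "fst y" "fst z" "snd y" "snd z"]
      by (simp add: collide_pair_def collide_def)
    show "ennreal ((3 - e) / 4) + ennreal ((1 + e) / 4) \<le> 1"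
      using e by (simp add: add_divide_distrib diff_divide_distrib flip: ennreal_plus)
  qed simp
  then have "(\<integral>\<^sup>+n. (\<integral>\<^sup>+p. ?c p \<partial>wild (collide_pair e) ?N \<pi> n) \<partial>?P) \<le> (\<integral>\<^sup>+n. (\<integral>\<^sup>+p. ?c p \<partial>\<pi>) \<partial>?P)"
    by (intro nn_integral_mono)
  then show "(\<integral>\<^sup>+p. ?c p \<partial>?\<rho>) \<le> (\<integral>\<^sup>+p. ?c p \<partial>\<pi>)"
    by (simp add: nn_integral_bind_pmf_kernel[OF W] measure_pmf.emeasure_space_1)
qed

theorem theorem5p2:
  fixes e \<beta> :: real and \<mu> :: "real measure"
    and f1 f2 :: "real \<Rightarrow> (real^3) measure" and f1_0 f2_0 :: "(real^3) measure"
  assumes "0 \<le> e" and "e \<le> 1"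
    and "prob_space \<mu>" and "sets \<mu> = sets borel"
    and "AE \<eta> in \<mu>. - e \<le> \<eta>"
    and "integrable \<mu> (\<lambda>\<eta>. \<eta>)" and "(LINT \<eta>|\<mu>. \<eta>) = 0"
    and "integrable \<mu> (\<lambda>\<eta>. \<eta>\<^sup>2)" and "(LINT \<eta>|\<mu>. \<eta>\<^sup>2) = \<beta>\<^sup>2"
    and "\<beta>\<^sup>2 = 1 - e\<^sup>2"
    and "f1_0 \<in> P2" and "f2_0 \<in> P2"
    and "mean_velocity f1_0 = 0" and "mean_velocity f2_0 = 0"
    and "is_solution e \<mu> f1_0 f1" and "is_solution e \<mu> f2_0 f2"
  shows "\<forall>t\<ge>0. (W2 (f1 t) (f2 t))\<^sup>2 \<le> (W2 f1_0 f2_0)\<^sup>2"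
proof (intro allI impI power_mono)
  fix t :: real assume t: "0 \<le> t"
  show "W2 (f1 t) (f2 t) \<le> W2 f1_0 f2_0"
    unfolding W2_def
  proof (rule INF_mono)
    fix \<pi> assume "\<pi> \<in> couplings f1_0 f2_0"
    then obtain \<rho> where "\<rho> \<in> couplings (f1 t) (f2 t)"
      "(\<integral>\<^sup>+ p. ennreal ((norm (fst p - snd p))\<^sup>2) \<partial>\<rho>) \<le> (\<integral>\<^sup>+ p. ennreal ((norm (fst p - snd p))\<^sup>2) \<partial>\<pi>)"
      using coupling_of_solutions[of \<mu> e f1_0 f1 f2_0 f2 t \<pi>] assms t by auto
    then show "\<exists>\<rho>\<in>couplings (f1 t) (f2 t).
        ennreal_sqrt (\<integral>\<^sup>+ p. ennreal ((norm (fst p - snd p))\<^sup>2) \<partial>\<rho>)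
        \<le> ennreal_sqrt (\<integral>\<^sup>+ p. ennreal ((norm (fst p - snd p))\<^sup>2) \<partial>\<pi>)"
      by (auto intro: ennreal_sqrt_mono)
  qed
qed simp

end
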